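(* Let $p$ be an odd prime number and let $\zeta$ be a primitive $p$-th root of unity. Then $$N_{\mathbb{Q}(\zeta)/\mathbb{Q}}(1+\zeta-\zeta^2)=L_p,$$ where $L_p$ is the $p$-th Lucas number.
   Context: The Lucas numbers are defined by $L_0=2$, $L_1=1$ and $L_{n+2}=L_n+L_{n+1}$ for every $n\ge 0$. $N_{\mathbb{Q}(\zeta)/\mathbb{Q}}$ denotes the field norm. *)

theory Defs
  imports "Jordan_Normal_Form.Determinant" "HOL-Algebra.Generated_Fields"
    "HOL-Algebra.Algebraic_Closure_Type" "HOL-Computational_Algebra.Primes"
begin

hide_const (open) Divisibility.prime

fun lucas :: "nat \<Rightarrow> nat" where
  "lucas 0 = 2"
| "lucas (Suc 0) = 1"
| "lucas (Suc (Suc n)) = lucas n + lucas (Suc n)"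

definition primitive_root_of_unity :: "nat \<Rightarrow> 'a :: field \<Rightarrow> bool" where
  "primitive_root_of_unity n z \<longleftrightarrow> n > 0 \<and> z ^ n = 1 \<and> (\<forall>k. 0 < k \<and> k < n \<longrightarrow> z ^ k \<noteq> 1)"

text \<open>The simple extension $\mathbb{Q}(z)$ inside a field of characteristic 0.\<close>

definition rat_adjoin :: "'a :: field_char_0 \<Rightarrow> 'a set" where
  "rat_adjoin z = generate_field ring_of_type_algebra (insert z \<rat>)"

interpretation rat_vs: vector_space "\<lambda>(q :: rat) (x :: 'a :: field_char_0). of_rat q * x"
  by unfold_locales (simp_all add: algebra_simps of_rat_add of_rat_mult)

definition rat_basis :: "'a :: field_char_0 list \<Rightarrow> 'a set \<Rightarrow> bool" where
  "rat_basis bs L \<longleftrightarrow> distinct bs \<and> rat_vs.independent (set bs) \<and> rat_vs.span (set bs) = L"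

text \<open>\<open>A\<close> represents multiplication by \<open>x\<close> in the ordered basis \<open>bs\<close>; column \<open>j\<close> holds the
  coordinates of \<open>x * bs ! j\<close>.\<close>

definition represents_mult :: "rat mat \<Rightarrow> 'a :: field_char_0 list \<Rightarrow> 'a \<Rightarrow> bool" where
  "represents_mult A bs x \<longleftrightarrow> A \<in> carrier_mat (length bs) (length bs) \<and>
     (\<forall>j < length bs. x * bs ! j = (\<Sum>i < length bs. of_rat (A $$ (i, j)) * bs ! i))"

text \<open>The norm $N_{L/\mathbb{Q}}(x)$ of \<open>x \<in> L\<close> for a subfield \<open>L\<close> of finite degree over
  $\mathbb{Q}$: the determinant of the $\mathbb{Q}$-linear map $y \mapsto xy$ on \<open>L\<close>, which does
  not depend on the basis. For other \<open>L\<close> or \<open>x\<close> the value is unspecified.\<close>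

definition field_norm :: "'a :: field_char_0 set \<Rightarrow> 'a \<Rightarrow> rat" where
  "field_norm L x = (THE d. \<exists>bs A. rat_basis bs L \<and> represents_mult A bs x \<and> d = det A)"

end

theory Submission
  imports Defs "Jordan_Normal_Form.Char_Poly" "HOL-Number_Theory.Cong"
begin

text \<open>
  Multiplication by $f(\zeta)$, written in a basis $g_j(\zeta)$ of $\mathbb{Q}(\zeta)$, is
  diagonalised by the matrix $(g_j(\zeta^k))$, so its determinant is $\prod_{k=1}^{p-1} f(\zeta^k)$.
  All that is needed of Galois theory is that a rational relation for $\zeta$ also holds for each
  $\zeta^k$, i.e. that $\Phi = 1 + X + \dots + X^{p-1}$ is irreducible. If $\Phi = ab$ over the
  integers with both factors nonconstant, then $p$ divides $a(1)$ and $b(1)$ (Kronecker's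
  argument), while $a(1)b(1) = p$. For $f = 1 + X - X^2 = -(\varphi - X)(\psi - X)$ with
  $\varphi + \psi = 1$ and $\varphi\psi = -1$ the product is $\Phi(\varphi)\Phi(\psi)$, which
  equals $\varphi^p + \psi^p = L_p$.
\<close>

hide_const (open) Divisibility.irreducible up_ring.monom up_ring.coeff Polynomials.degree
  Polynomials.lead_coeff

section \<open>The polynomial \<Phi>\<close>

text \<open>For prime \<open>p\<close> this is the \<open>p\<close>-th cyclotomic polynomial. It is
  polymorphic because it is needed over the integers and over the field \<open>'a\<close>.\<close>

definition prime_cyclotomic :: "nat \<Rightarrow> 'a :: comm_ring_1 poly" where
  "prime_cyclotomic p = (\<Sum>i<p. monom 1 i)"

abbreviation ipoly :: "int poly \<Rightarrow> 'a :: field_char_0 \<Rightarrow> 'a" where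
  "ipoly g x \<equiv> poly (map_poly of_int g) x"

abbreviation rpoly :: "rat poly \<Rightarrow> 'a :: field_char_0 \<Rightarrow> 'a" where
  "rpoly g x \<equiv> poly (map_poly of_rat g) x"

lemma poly_prime_cyclotomic: "poly (prime_cyclotomic p) x = (\<Sum>i<p. x ^ i)"
  by (simp add: prime_cyclotomic_def poly_sum poly_monom)

lemma coeff_prime_cyclotomic: "coeff (prime_cyclotomic p) i = (if i < p then 1 else 0)"
  by (simp add: prime_cyclotomic_def coeff_sum)

lemma degree_prime_cyclotomic:
  assumes "p > 0" shows "degree (prime_cyclotomic p :: 'a :: comm_ring_1 poly) = p - 1"
proof (rule antisym)
  show "degree (prime_cyclotomic p :: 'a poly) \<le> p - 1"
    using assms by (intro degree_le) (auto simp: coeff_prime_cyclotomic)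
  show "p - 1 \<le> degree (prime_cyclotomic p :: 'a poly)"
    using assms by (intro le_degree) (auto simp: coeff_prime_cyclotomic)
qed

lemma lead_coeff_prime_cyclotomic: "p > 0 \<Longrightarrow> lead_coeff (prime_cyclotomic p) = 1"
  by (simp add: degree_prime_cyclotomic coeff_prime_cyclotomic)

lemma ipoly_prime_cyclotomic: "ipoly (prime_cyclotomic p) x = (\<Sum>i<p. x ^ i)"
proof -
  have "map_poly of_int (prime_cyclotomic p) = (prime_cyclotomic p :: 'a poly)"
    by (rule poly_eqI) (simp add: coeff_prime_cyclotomic)
  then show ?thesis by (simp add: poly_prime_cyclotomic)
qed

section \<open>Division and denominators for integer polynomials\<close>

text \<open>Pseudo-division scales the dividend by a power of the leading coefficient of
  \<open>g\<close>, which is 1 here.\<close>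

lemma monic_division:
  fixes f g :: "int poly"
  assumes "lead_coeff g = 1"
  obtains q r where "f = g * q + r" "r = 0 \<or> degree r < degree g"
proof -
  obtain q r where qr: "pseudo_divmod f g = (q, r)" by force
  moreover have "g \<noteq> 0" using assms by auto
  ultimately show ?thesis using pseudo_divmod[of g f q r] assms that by simp
qed

text \<open>The multiplier is the product of the denominators of the coefficients, built up one
  coefficient at a time.\<close>

lemma clear_denominators:
  fixes g :: "rat poly"
  obtains c :: int and h :: "int poly" where "c \<noteq> 0" "smult (of_int c) g = map_poly of_int h"
proof -
  have "\<exists>c h. c \<noteq> 0 \<and> smult (of_int c) g = map_poly of_int h"
  proof (induction g)
    case 0
    show ?case by (rule exI[of _ 1], rule exI[of _ 0]) simp
  next
    case (pCons a g)
    then obtain c h where h: "c \<noteq> 0" "smult (of_int c) g = map_poly of_int h" by blast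
    obtain n d where nd: "quotient_of a = (n, d)" by force
    then have a: "a = of_int n / of_int d" "d > 0"
      by (auto dest: quotient_of_div quotient_of_denom_pos)
    have "smult (of_int (c * d)) (pCons a g) =
        pCons (of_int (c * n)) (smult (of_int d) (smult (of_int c) g))"
      using a(2) by (simp add: a(1) field_simps)
    also have "\<dots> = map_poly of_int (pCons (c * n) (smult d h))"
      by (simp add: h(2) of_int_hom.map_poly_pCons_hom of_int_hom.map_poly_hom_smult)
    finally show ?case using h(1) a(2) by (intro exI[of _ "c * d"]) auto
  qed
  then show ?thesis using that by blast
qed

section \<open>Powers of a primitive root of unity of prime order\<close>

text \<open>The field stays arbitrary because the final proof interprets the locale twice: in the
  given field and in its algebraic closure.\<close>

locale prime_root_of_unity =
  fixes p :: nat and \<zeta> :: "'a :: field_char_0"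
  assumes prime_p: "prime p" and primitive: "primitive_root_of_unity p \<zeta>"
begin

lemma p_gt_1: "p > 1" by (rule prime_gt_1_nat[OF prime_p])

lemma root_pow_p: "\<zeta> ^ p = 1" using primitive by (simp add: primitive_root_of_unity_def)

lemma root_nz: "\<zeta> \<noteq> 0" using root_pow_p p_gt_1 by (auto simp: power_0_left)

lemma root_pow_mod: "\<zeta> ^ (n mod p) = \<zeta> ^ n"
proof -
  have "\<zeta> ^ n = \<zeta> ^ (p * (n div p) + n mod p)" by simp
  also have "\<dots> = \<zeta> ^ (n mod p)" by (simp only: power_add power_mult root_pow_p) simp
  finally show ?thesis ..
qed

lemma inj_on_root_pow: "inj_on (\<lambda>k. \<zeta> ^ k) {..<p}"
proof -
  have "i = j" if "i \<le> j" "j < p" "\<zeta> ^ i = \<zeta> ^ j" for i j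
  proof (rule ccontr)
    assume "i \<noteq> j"
    then have "0 < j - i" "j - i < p" using that by auto
    moreover have "\<zeta> ^ i * \<zeta> ^ (j - i) = \<zeta> ^ i"
      using that(1,3) by (metis le_add_diff_inverse power_add)
    then have "\<zeta> ^ (j - i) = 1" using root_nz by simp
    ultimately show False using primitive by (auto simp: primitive_root_of_unity_def)
  qed
  then show ?thesis by (intro inj_onI) (metis lessThan_iff nat_le_linear)
qed

text \<open>Provides the \<open>p - 1\<close> distinct points at which polynomials are compared
  below.\<close>

lemma card_conjugates: "card ((\<lambda>k. \<zeta> ^ k) ` {1..<p}) = p - 1"
  by (subst card_image) (auto intro: inj_on_subset[OF inj_on_root_pow])

lemma root_pow_neq_1: "k \<in> {1..<p} \<Longrightarrow> \<zeta> ^ k \<noteq> 1"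
  using primitive by (auto simp: primitive_root_of_unity_def)

lemma sum_conjugate_powers:
  assumes "k \<in> {1..<p}"
  shows "(\<Sum>i<p. (\<zeta> ^ k) ^ i) = 0"
proof -
  have "(\<zeta> ^ k) ^ p = 1" by (metis power_commutes power_mult root_pow_p mult.commute power_one)
  then show ?thesis using root_pow_neq_1[OF assms] by (simp add: geometric_sum)
qed

text \<open>Since \<open>j\<close> is invertible modulo \<open>p\<close>, take \<open>k\<close>
  congruent to \<open>m\<close> divided by \<open>j\<close>. In terms of exponents, this is
  transitivity of the Galois group on the conjugates.\<close>

lemma exponent_transitive:
  assumes "j \<in> {1..<p}" "m \<in> {1..<p}"
  obtains k where "k \<in> {1..<p}" "(\<zeta> ^ j) ^ k = \<zeta> ^ m"
proof -
  have "\<not> p dvd j" using assms(1) by (auto dest: dvd_imp_le)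
  then have "coprime j p"
    using prime_imp_coprime[OF prime_p] by (simp add: coprime_commute)
  then obtain x where "[j * x = 1] (mod p)" using cong_solve_coprime_nat by fastforce
  then have "[j * (x * m) = m] (mod p)" using cong_scalar_right[of "j * x" 1 p m] by (simp add: mult.assoc)
  then obtain k where k: "[j * k = m] (mod p)" ..
  then have e: "j * (k mod p) mod p = m"
    using assms by (simp add: cong_def mod_mult_right_eq)
  have "k mod p \<noteq> 0" using e assms by (intro notI) auto
  moreover have "(\<zeta> ^ j) ^ (k mod p) = \<zeta> ^ m" using e root_pow_mod
    by (metis power_mult)
  ultimately show ?thesis using that[of "k mod p"] p_gt_1 by simp
qed

section \<open>Irreducibility of \<Phi> and rational relations between conjugates\<close>

text \<open>The remainder modulo \<Phi> has degree below \<open>p - 1\<close> but vanishes at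
  \<open>p - 1\<close> points. Once \<Phi> is known to be prime, the single root \<zeta> will
  suffice.\<close>

lemma prime_cyclotomic_dvd_of_conjugate_roots:
  assumes "\<And>j. j \<in> {1..<p} \<Longrightarrow> ipoly h (\<zeta> ^ j) = 0"
  shows "prime_cyclotomic p dvd h"
proof -
  have p: "p > 0" using p_gt_1 by simp
  obtain q r where qr: "h = prime_cyclotomic p * q + r"
      "r = 0 \<or> degree r < degree (prime_cyclotomic p :: int poly)"
    using monic_division[OF lead_coeff_prime_cyclotomic[OF p]] by blast
  have "r = 0"
  proof (rule ccontr)
    assume "r \<noteq> 0"
    with qr(2) have deg: "degree r < p - 1" by (simp add: degree_prime_cyclotomic p)
    have "map_poly of_int r = (0 :: 'a poly)"
    proof (rule poly_eqI_degree)
      fix x assume "x \<in> (\<lambda>k. \<zeta> ^ k) ` {1..<p}"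
      then show "ipoly r x = poly 0 x"
        using assms sum_conjugate_powers
        by (auto simp: qr(1) of_int_poly_hom.hom_add of_int_poly_hom.hom_mult ipoly_prime_cyclotomic)
    qed (use deg card_conjugates in auto)
    with \<open>r \<noteq> 0\<close> show False by simp
  qed
  with qr show ?thesis by simp
qed

text \<open>Every $\zeta^j$ is a root of $\prod_k a(X^k)$, so $\Phi$ divides this product; evaluate at $1$.\<close>

lemma p_dvd_poly_1_of_conjugate_root:
  fixes a :: "int poly"
  assumes m: "m \<in> {1..<p}" and root: "ipoly a (\<zeta> ^ m) = 0"
  shows "int p dvd poly a 1"
proof -
  define G where "G = (\<Prod>k\<in>{1..<p}. pcompose a (monom 1 k))"
  have "prime_cyclotomic p dvd G"
  proof (rule prime_cyclotomic_dvd_of_conjugate_roots)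
    fix j assume "j \<in> {1..<p}"
    then obtain k where k: "k \<in> {1..<p}" "(\<zeta> ^ j) ^ k = \<zeta> ^ m"
      using exponent_transitive[OF _ m] by blast
    have "ipoly (pcompose a (monom 1 k)) (\<zeta> ^ j) = 0"
      using root k(2) by (simp add: of_int_hom.map_poly_pcompose poly_pcompose poly_monom)
    then show "ipoly G (\<zeta> ^ j) = 0"
      unfolding G_def of_int_poly_hom.hom_prod poly_prod using k(1)
      by (intro prod_zero) auto
  qed
  then have "poly (prime_cyclotomic p) 1 dvd poly G 1" by (auto elim!: dvdE)
  then have "int p dvd poly a 1 ^ (p - 1)"
    by (simp add: G_def poly_prod poly_pcompose poly_monom poly_prime_cyclotomic)
  then show ?thesis using prime_p prime_dvd_power[of "int p"] by simp
qed

text \<open>Integer polynomials form a factorial ring, so irreducibility gives primality. A constant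
  factor divides the leading coefficient 1 and is a unit; two nonconstant factors are excluded by
  their values at 1.\<close>

lemma prime_elem_prime_cyclotomic: "prime_elem (prime_cyclotomic p :: int poly)"
proof (rule Polynomial_Factorial.irreducible_imp_prime_poly, rule Factorial_Ring.irreducibleI)
  have p: "p > 0" using p_gt_1 by simp
  let ?P = "prime_cyclotomic p :: int poly"
  have deg: "degree ?P = p - 1" and monic: "lead_coeff ?P = 1"
    using degree_prime_cyclotomic[OF p] lead_coeff_prime_cyclotomic[OF p] by blast+
  show nz: "?P \<noteq> 0" using monic by auto
  show "\<not> ?P dvd 1"
    using deg p_gt_1 by (auto simp: is_unit_poly_iff)
  have unit: "c dvd 1" if cd: "?P = c * d" "degree c = 0" for c d :: "int poly"
  proof -
    obtain x where "c = [:x:]" using cd(2) by (auto elim: degree_eq_zeroE)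
    moreover from this have "x dvd lead_coeff ?P" by (simp add: cd(1) lead_coeff_mult)
    ultimately show ?thesis using monic by (simp add: is_unit_const_poly_iff)
  qed
  \<comment> \<open>If \<open>c\<close> vanished at no conjugate, then \<open>d\<close> would vanish
    at all of them, so \<Phi> would divide \<open>d\<close>, whose degree is smaller.\<close>
  have root: "\<exists>m\<in>{1..<p}. ipoly c (\<zeta> ^ m) = 0" if "?P = c * d" "degree c \<noteq> 0" for c d :: "int poly"
  proof (rule ccontr)
    assume *: "\<not> ?thesis"
    have "?P dvd d"
    proof (rule prime_cyclotomic_dvd_of_conjugate_roots)
      fix j assume j: "j \<in> {1..<p}"
      have "ipoly ?P (\<zeta> ^ j) = 0" using sum_conjugate_powers[OF j] by (simp add: ipoly_prime_cyclotomic)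
      with * j show "ipoly d (\<zeta> ^ j) = 0" by (auto simp: that(1) of_int_poly_hom.hom_mult)
    qed
    moreover have "d \<noteq> 0" using that(1) nz by auto
    ultimately have "degree ?P \<le> degree d" by (rule dvd_imp_degree_le)
    moreover have "degree ?P = degree c + degree d"
      using that(1) nz by (metis degree_mult_eq mult_eq_0_iff)
    ultimately show False using that(2) by simp
  qed
  fix a b assume ab: "?P = a * b"
  show "a dvd 1 \<or> b dvd 1"
  proof (rule ccontr)
    assume "\<not> ?thesis"
    then have "degree a \<noteq> 0" "degree b \<noteq> 0"
      using unit[of a b] unit[of b a] ab by (auto simp: mult.commute)
    then have "int p dvd poly a 1" "int p dvd poly b 1"
      using root[of a b] root[of b a] ab p_dvd_poly_1_of_conjugate_root by (auto simp: mult.commute)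
    then have "int p * int p dvd poly ?P 1" unfolding ab by (simp add: mult_dvd_mono)
    then have "p * p dvd p" by (simp add: poly_prime_cyclotomic flip: of_nat_mult)
    then show False using p_gt_1 by (auto dest: dvd_imp_le)
  qed
qed

text \<open>\<open>g\<close> below has minimal degree among the nonzero polynomials vanishing at \<open>\<zeta>\<close>. Primality of
  \<open>\<Phi>\<close> is used inside $\mathbb{Z}[X]$, which avoids passing to $\mathbb{Q}[X]$.\<close>

lemma prime_cyclotomic_dvd_of_root:
  assumes "ipoly h \<zeta> = 0"
  shows "prime_cyclotomic p dvd h"
proof (cases "h = 0")
  case False
  have p: "p > 0" using p_gt_1 by simp
  let ?P = "prime_cyclotomic p :: int poly"
  have nz: "?P \<noteq> 0" using prime_elem_prime_cyclotomic by auto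
  have P0: "ipoly ?P \<zeta> = 0"
    using sum_conjugate_powers[of 1] p_gt_1 by (simp add: ipoly_prime_cyclotomic)
  have "\<exists>g. (g \<noteq> 0 \<and> ipoly g \<zeta> = 0) \<and> (\<forall>h. h \<noteq> 0 \<and> ipoly h \<zeta> = 0 \<longrightarrow> degree g \<le> degree h)"
    by (rule ex_has_least_nat[of "\<lambda>g. g \<noteq> 0 \<and> ipoly g \<zeta> = 0" h degree]) (use False assms in auto)
  then obtain g where g: "g \<noteq> 0" "ipoly g \<zeta> = 0"
    and min: "\<And>h. h \<noteq> 0 \<Longrightarrow> ipoly h \<zeta> = 0 \<Longrightarrow> degree g \<le> degree h" by blast
  obtain q r where qr: "pseudo_divmod ?P g = (q, r)" by force
  \<comment> \<open>The factor that pseudo-division by the possibly non-monic \<open>g\<close> puts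
    in front of \<Phi>.\<close>
  define c where "c = lead_coeff g ^ (Suc (degree ?P) - degree g)"
  have c: "c \<noteq> 0" using g(1) by (simp add: c_def)
  have eq: "smult c ?P = g * q + r" and r: "r = 0 \<or> degree r < degree g"
    using pseudo_divmod[OF g(1) qr] by (auto simp: c_def)
  have "ipoly r \<zeta> = 0"
    using arg_cong[OF eq, of "\<lambda>f. ipoly f \<zeta>"] g(2) P0
    by (simp add: of_int_poly_hom.hom_add of_int_poly_hom.hom_mult of_int_hom.map_poly_hom_smult)
  with min[of r] r have "r = 0" by (cases "r = 0") auto
  with eq have eq: "smult c ?P = g * q" by simp
  have "?P dvd g * q" by (simp flip: eq add: dvd_smult)
  then have "?P dvd g"
  proof (rule disjE[OF prime_elem_dvd_multD[OF prime_elem_prime_cyclotomic]])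
    \<comment> \<open>Cancelling \<Phi> makes \<open>g\<close> a divisor of the nonzero constant
      \<open>c\<close>, which is impossible because \<open>g\<close> vanishes at \<zeta>.\<close>
    assume "?P dvd q"
    then obtain s where "q = ?P * s" by blast
    with eq have "?P * [:c:] = ?P * (g * s)" by (simp add: algebra_simps)
    then have "[:c:] = g * s" using nz mult_left_cancel by blast
    then have "ipoly [:c:] \<zeta> = 0" using g(2) by (simp add: of_int_poly_hom.hom_mult)
    with c show ?thesis by simp
  qed
  \<comment> \<open>So \<Phi> has minimal degree as well, and being monic it can divide
    \<open>h\<close> with remainder over the integers.\<close>
  then have deg: "degree ?P \<le> degree g" using g(1) by (rule dvd_imp_degree_le)
  obtain q r where qr: "h = ?P * q + r" "r = 0 \<or> degree r < degree ?P"
    using monic_division[OF lead_coeff_prime_cyclotomic[OF p]] by blast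
  have "ipoly r \<zeta> = 0" using assms P0
    by (simp add: qr(1) of_int_poly_hom.hom_add of_int_poly_hom.hom_mult)
  with min[of r] deg qr(2) have "r = 0" by (cases "r = 0") auto
  with qr show ?thesis by simp
qed simp

text \<open>This stands in for the automorphism sending \<zeta> to \<open>\<zeta> ^ k\<close>: after
  clearing denominators the relation is a multiple of \<Phi>, which vanishes at every
  conjugate.\<close>

lemma rpoly_conjugate:
  assumes "rpoly g \<zeta> = 0" "k \<in> {1..<p}"
  shows "rpoly g (\<zeta> ^ k) = 0"
proof -
  obtain c h where h: "c \<noteq> 0" "smult (of_int c) g = map_poly of_int h"
    by (rule clear_denominators)
  have *: "of_int c * rpoly g x = ipoly h x" for x :: 'a
  proof -
    have "of_int c * rpoly g x = rpoly (smult (of_int c) g) x"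
      by (simp add: of_rat_hom.map_poly_hom_smult)
    also have "map_poly of_rat (smult (of_int c) g) = (map_poly of_int h :: 'a poly)"
      unfolding h(2) by (rule poly_eqI) simp
    finally show ?thesis .
  qed
  have "ipoly h \<zeta> = 0" using *[of \<zeta>] assms(1) by simp
  then have "prime_cyclotomic p dvd h" by (rule prime_cyclotomic_dvd_of_root)
  then have "ipoly h (\<zeta> ^ k) = 0" using sum_conjugate_powers[OF assms(2)]
    by (auto elim!: dvdE simp: of_int_poly_hom.hom_mult ipoly_prime_cyclotomic)
  with *[of "\<zeta> ^ k"] h(1) show ?thesis by simp
qed

text \<open>All \<open>p - 1\<close> conjugates would be roots, too many for the degree.\<close>

lemma rpoly_eq_0_imp:
  assumes "rpoly g \<zeta> = 0" "degree g < p - 1"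
  shows "g = 0"
proof -
  have "map_poly of_rat g = (0 :: 'a poly)"
  proof (rule poly_eqI_degree)
    fix x assume "x \<in> (\<lambda>k. \<zeta> ^ k) ` {1..<p}"
    then show "rpoly g x = poly 0 x" using rpoly_conjugate[OF assms(1)] by auto
  qed (use assms(2) card_conjugates in auto)
  then show ?thesis by simp
qed

end

section \<open>Vandermonde matrices and rational coordinates\<close>

interpretation of_rat_poly_hom: map_poly_idom_hom "of_rat :: rat \<Rightarrow> 'a :: field_char_0" ..

lemma rpoly_sum_monom: "rpoly (\<Sum>i<n. monom (c i) i) x = (\<Sum>i<n. of_rat (c i) * x ^ i)"
  by (simp add: of_rat_poly_hom.hom_sum poly_sum poly_monom)

text \<open>A kernel vector lists the coefficients of a polynomial of degree below \<open>n\<close>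
  with \<open>n\<close> distinct roots.\<close>

lemma det_vandermonde_nonzero:
  fixes x :: "nat \<Rightarrow> 'a :: Fields.field"
  assumes inj: "inj_on x {..<n}"
  shows "det (mat n n (\<lambda>(k, i). x k ^ i)) \<noteq> 0"
proof
  let ?V = "mat n n (\<lambda>(k, i). x k ^ i)"
  assume "det ?V = 0"
  then obtain v where v: "v \<in> carrier_vec n" "v \<noteq> 0\<^sub>v n" "?V *\<^sub>v v = 0\<^sub>v n"
    using det_0_iff_vec_prod_zero_field[of ?V n] by auto
  define f where "f = (\<Sum>i<n. monom (v $ i) i)"
  have coeff: "coeff f i = (if i < n then v $ i else 0)" for i
    by (simp add: f_def coeff_sum)
  have "f = 0"
  \<comment> \<open>For \<open>n = 0\<close> the strict bound of the degree by the number of points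
    fails, but \<open>f\<close> is then an empty sum.\<close>
  proof (cases "n = 0")
    case False
    show ?thesis
    proof (rule poly_eqI_degree)
      fix y assume "y \<in> x ` {..<n}"
      then obtain k where k: "k < n" "y = x k" by auto
      have "(?V *\<^sub>v v) $ k = 0" using v(3) k(1) by simp
      then have "(\<Sum>i<n. x k ^ i * v $ i) = 0"
        using k(1) v(1) by (simp add: scalar_prod_def atLeast0LessThan)
      then show "poly f y = poly 0 y"
        by (simp add: f_def poly_sum poly_monom k(2) mult.commute)
    next
      have "degree f \<le> n - 1" using False by (intro degree_le) (auto simp: coeff)
      then show "degree f < card (x ` {..<n})" using False by (simp add: card_image inj)
    qed (use False in \<open>simp add: card_image inj\<close>)
  qed (simp add: f_def)
  then have "v $ i = 0" if "i < n" for i using coeff[of i] that by simp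
  then have "v = 0\<^sub>v n" using v(1) by auto
  with v(2) show False ..
qed

lemma rat_span_coordinates:
  assumes "distinct bs" "x \<in> rat_vs.span (set bs)"
  obtains c where "x = (\<Sum>j<length bs. of_rat (c j) * bs ! j)"
proof -
  obtain u where "x = (\<Sum>v\<in>set bs. of_rat (u v) * v)"
    using assms(2) by (auto simp: rat_vs.span_finite)
  also have "\<dots> = (\<Sum>j<length bs. of_rat (u (bs ! j)) * bs ! j)"
    by (rule sum.reindex_bij_betw[symmetric, OF bij_betw_nth]) (use assms(1) in auto)
  finally show ?thesis by (rule that)
qed

section \<open>The power basis of the field generated by \<zeta>\<close>

context prime_root_of_unity
begin

abbreviation power_basis :: "'a set" where
  "power_basis \<equiv> (\<lambda>i. \<zeta> ^ i) ` {..<p - 1}"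

lemma inj_on_power_basis: "inj_on (\<lambda>i. \<zeta> ^ i) {..<p - 1}"
  by (rule inj_on_subset[OF inj_on_root_pow]) auto

lemma card_power_basis: "card power_basis = p - 1"
  by (rule trans[OF card_image[OF inj_on_power_basis]]) simp

lemma independent_power_basis: "rat_vs.independent power_basis"
proof (rule rat_vs.independent_if_scalars_zero)
  fix f x assume sum: "(\<Sum>x\<in>power_basis. of_rat (f x) * x) = 0" and x: "x \<in> power_basis"
  let ?g = "\<Sum>i<p - 1. monom (f (\<zeta> ^ i)) i"
  have coeff: "coeff ?g i = (if i < p - 1 then f (\<zeta> ^ i) else 0)" for i
    by (simp add: coeff_sum)
  have "rpoly ?g \<zeta> = 0"
    using sum by (simp only: rpoly_sum_monom sum.reindex[OF inj_on_power_basis] o_def)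
  moreover have "degree ?g \<le> p - 2"
    by (intro degree_le) (auto simp: coeff simp del: One_nat_def)
  \<comment> \<open>Subtraction is truncated, so \<open>p > 1\<close> is what makes
    \<open>p - 2\<close> smaller than \<open>p - 1\<close>.\<close>
  then have "degree ?g < p - 1" using p_gt_1 by linarith
  ultimately have "?g = 0" by (rule rpoly_eq_0_imp)
  moreover obtain i where "i < p - 1" "x = \<zeta> ^ i" using x by blast
  ultimately show "f x = 0" using coeff[of i] by (simp only: coeff_0 if_True)
qed simp

text \<open>Exponents reduce modulo \<open>p\<close>; the one remaining power
  \<open>\<zeta> ^ (p - 1)\<close> is eliminated by the vanishing sum of all powers.\<close>

lemma root_pow_in_span: "\<zeta> ^ n \<in> rat_vs.span power_basis"
proof -
  have base: "\<zeta> ^ i \<in> rat_vs.span power_basis" if "i < p - 1" for i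
    using that by (intro rat_vs.span_base) auto
  have "{..<p} = insert (p - 1) {..<p - 1}" using p_gt_1 by auto
  then have "\<zeta> ^ (p - 1) = - (\<Sum>i<p - 1. \<zeta> ^ i)"
    using sum_conjugate_powers[of 1] p_gt_1 by (simp add: eq_neg_iff_add_eq_0)
  also have "\<dots> \<in> rat_vs.span power_basis"
    by (intro rat_vs.span_neg rat_vs.span_sum base) auto
  finally have last: "\<zeta> ^ (p - 1) \<in> rat_vs.span power_basis" .
  have "n mod p < p - 1 \<or> n mod p = p - 1" using mod_less_divisor[of p n] p_gt_1 by linarith
  then have "\<zeta> ^ (n mod p) \<in> rat_vs.span power_basis" using base last by metis
  then show ?thesis by (simp add: root_pow_mod)
qed

text \<open>The span makes closure under linear operations immediate, the set of polynomial values
  makes closure under products immediate.\<close>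

lemma span_power_basis: "rat_vs.span power_basis = range (\<lambda>g. rpoly g \<zeta>)"
proof (rule antisym)
  show "rat_vs.span power_basis \<subseteq> range (\<lambda>g. rpoly g \<zeta>)"
  proof (rule rat_vs.span_minimal)
    have "\<zeta> ^ i = rpoly (monom 1 i) \<zeta>" for i by (simp add: poly_monom)
    then show "power_basis \<subseteq> range (\<lambda>g. rpoly g \<zeta>)" by blast
    show "rat_vs.subspace (range (\<lambda>g. rpoly g \<zeta>))"
    proof (rule rat_vs.subspaceI)
      show "0 \<in> range (\<lambda>g. rpoly g \<zeta>)" by (rule range_eqI[of _ _ 0]) simp
      fix x assume "x \<in> range (\<lambda>g. rpoly g \<zeta>)"
      then obtain g where g: "x = rpoly g \<zeta>" by blast
      have "of_rat c * x = rpoly (smult c g) \<zeta>" for c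
        by (simp add: g of_rat_hom.map_poly_hom_smult)
      then show "of_rat c * x \<in> range (\<lambda>g. rpoly g \<zeta>)" for c by blast
      fix y assume "y \<in> range (\<lambda>g. rpoly g \<zeta>)"
      then obtain h where h: "y = rpoly h \<zeta>" by blast
      have "x + y = rpoly (g + h) \<zeta>" by (simp add: g h of_rat_poly_hom.hom_add)
      then show "x + y \<in> range (\<lambda>g. rpoly g \<zeta>)" by blast
    qed
  qed
  show "range (\<lambda>g. rpoly g \<zeta>) \<subseteq> rat_vs.span power_basis"
  proof clarify
    fix g
    have "rpoly g \<zeta> = (\<Sum>i\<le>degree g. of_rat (coeff g i) * \<zeta> ^ i)"
      by (simp add: poly_altdef)
    also have "\<dots> \<in> rat_vs.span power_basis"
      by (intro rat_vs.span_sum rat_vs.span_scale root_pow_in_span)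
    finally show "rpoly g \<zeta> \<in> rat_vs.span power_basis" .
  qed
qed

text \<open>Multiplication by \<open>y\<close> maps the basis to an independent set of the same size, whose span
  must contain \<open>1\<close>.\<close>

lemma inverse_in_span:
  assumes y: "y \<in> rat_vs.span power_basis" "y \<noteq> 0"
  shows "inverse y \<in> rat_vs.span power_basis"
proof -
  let ?S = "(*) y ` power_basis"
  have inj: "inj_on ((*) y) power_basis" using y(2) by (auto intro: inj_onI)
  have sum: "(\<Sum>v\<in>?S. of_rat (f v) * v) = y * (\<Sum>b\<in>power_basis. of_rat (f (y * b)) * b)" for f
    by (subst sum.reindex[OF inj]) (simp add: sum_distrib_left algebra_simps)
  have "rat_vs.independent ?S"
  proof (rule rat_vs.independent_if_scalars_zero)
    fix f x assume "(\<Sum>v\<in>?S. of_rat (f v) * v) = 0" and x: "x \<in> ?S"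
    then have "(\<Sum>b\<in>power_basis. of_rat (f (y * b)) * b) = 0" using sum y(2) by simp
    then have "f (y * b) = 0" if "b \<in> power_basis" for b
      using rat_vs.independentD[OF independent_power_basis, of power_basis "\<lambda>b. f (y * b)" b] that
      by simp
    with x show "f x = 0" by auto
  qed simp
  have mult: "a * b \<in> rat_vs.span power_basis"
    if ab: "a \<in> rat_vs.span power_basis" "b \<in> rat_vs.span power_basis" for a b
  proof -
    obtain g h where gh: "a = rpoly g \<zeta>" "b = rpoly h \<zeta>"
      using ab unfolding span_power_basis by blast
    have "a * b = rpoly (g * h) \<zeta>" by (simp add: gh of_rat_poly_hom.hom_mult)
    then show ?thesis unfolding span_power_basis by blast
  qed
  have one: "1 \<in> rat_vs.span power_basis" using root_pow_in_span[of 0] by simp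
  have "1 \<in> rat_vs.span ?S"
  \<comment> \<open>Otherwise adjoining 1 would give \<open>p\<close> independent vectors in a space
    spanned by \<open>p - 1\<close>.\<close>
  proof (rule ccontr)
    assume *: "1 \<notin> rat_vs.span ?S"
    have "rat_vs.independent (insert 1 ?S)"
      using * \<open>rat_vs.independent ?S\<close> by (rule rat_vs.independent_insertI)
    moreover have "insert 1 ?S \<subseteq> rat_vs.span power_basis"
    proof (intro insert_subsetI one image_subsetI)
      fix b assume "b \<in> power_basis"
      then show "y * b \<in> rat_vs.span power_basis" by (intro mult y(1) rat_vs.span_base)
    qed
    ultimately have "card (insert 1 ?S) \<le> card power_basis"
      using rat_vs.independent_span_bound[of power_basis "insert 1 ?S"]
        finite_imageI[OF finite_lessThan] by blast
    moreover have "1 \<notin> ?S" using * rat_vs.span_base by (rule contrapos_nn)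
    then have "card (insert 1 ?S) = Suc (card ?S)"
      by (rule card_insert_disjoint[rotated]) simp
    ultimately show False using card_image[OF inj] by linarith
  qed
  then obtain f where "1 = (\<Sum>v\<in>?S. of_rat (f v) * v)"
    by (auto simp: rat_vs.span_finite)
  then have "y * (\<Sum>b\<in>power_basis. of_rat (f (y * b)) * b) = 1" by (simp only: sum)
  then have "inverse y = (\<Sum>b\<in>power_basis. of_rat (f (y * b)) * b)" by (rule inverse_unique)
  also have "\<dots> \<in> rat_vs.span power_basis"
    by (intro rat_vs.span_sum rat_vs.span_scale rat_vs.span_base)
  finally show ?thesis .
qed

text \<open>The polynomial values contain the generators and are closed under the field operations;
  only inverses are hard, and \<open>inverse_in_span\<close> handles them. The converse evaluates a
  polynomial by Horner's scheme.\<close>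

lemma rat_adjoin_eq: "rat_adjoin \<zeta> = range (\<lambda>g. rpoly g \<zeta>)"
proof -
  let ?R = "ring_of_type_algebra :: 'a ring"
  interpret R: Ring.field ?R by (rule field_from_type_algebra)
  \<comment> \<open>Translates the operations of the ring record into those of the type
    class.\<close>
  have R: "carrier ?R = UNIV" "\<And>x y. x \<otimes>\<^bsub>?R\<^esub> y = x * y" "\<And>x y. x \<oplus>\<^bsub>?R\<^esub> y = x + y"
    "\<one>\<^bsub>?R\<^esub> = 1" "\<zero>\<^bsub>?R\<^esub> = 0" by (simp_all add: ring_of_type_algebra_def)
  have neg: "\<ominus>\<^bsub>?R\<^esub> x = - x" for x
    by (rule R.minus_equality) (simp_all add: R)
  have inv: "inv\<^bsub>?R\<^esub> x = inverse x" if "x \<noteq> 0" for x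
    by (rule R.comm_inv_char) (simp_all add: R that)
  let ?F = "generate_field ?R (insert \<zeta> \<rat>)"
  have "x \<in> range (\<lambda>g. rpoly g \<zeta>)" if "x \<in> ?F" for x
    using that
  proof (induction rule: generate_field.induct)
    case one
    show ?case by (rule range_eqI[of _ _ 1]) (simp add: R)
  next
    case (incl h)
    then consider "h = \<zeta>" | c where "h = of_rat c" by (auto elim: Rats_cases)
    then show ?case
    proof cases
      case 1
      then show ?thesis by (intro range_eqI[of _ _ "[:0, 1:]"]) simp
    next
      case 2
      then show ?thesis by (intro range_eqI[of _ _ "[:c:]"]) (simp add: of_rat_hom.map_poly_pCons_hom)
    qed
  next
    case (a_inv h)
    from a_inv.IH show ?case unfolding neg span_power_basis[symmetric] by (rule rat_vs.span_neg)
  next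
    case (m_inv h)
    then have nz: "h \<noteq> 0" by (simp add: R)
    show ?case unfolding inv[OF nz]
      by (rule inverse_in_span[OF _ nz, unfolded span_power_basis]) (rule m_inv.IH)
  next
    case (eng_add h1 h2)
    from eng_add.IH show ?case unfolding R span_power_basis[symmetric] by (rule rat_vs.span_add)
  next
    case (eng_mult h1 h2)
    then obtain g1 g2 where "h1 = rpoly g1 \<zeta>" "h2 = rpoly g2 \<zeta>" by blast
    then show ?case unfolding R
      by (intro range_eqI[of _ _ "g1 * g2"]) (simp add: of_rat_poly_hom.hom_mult)
  qed
  moreover have "rpoly g \<zeta> \<in> ?F" for g
  proof (induction g)
    case 0
    show ?case by (rule generate_field.incl) simp
  next
    case (pCons a g)
    have "of_rat a \<oplus>\<^bsub>?R\<^esub> (\<zeta> \<otimes>\<^bsub>?R\<^esub> rpoly g \<zeta>) \<in> ?F"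
      by (intro generate_field.eng_add generate_field.eng_mult pCons.IH generate_field.incl) auto
    then show ?case by (simp add: R of_rat_hom.map_poly_pCons_hom)
  qed
  ultimately show ?thesis unfolding rat_adjoin_def by blast
qed

section \<open>The norm as a product over conjugates\<close>

lemma rat_basis_length:
  assumes "rat_basis bs (rat_adjoin \<zeta>)"
  shows "length bs = p - 1"
proof -
  have bs: "distinct bs" "rat_vs.independent (set bs)" "rat_vs.span (set bs) = rat_vs.span power_basis"
    using assms unfolding rat_basis_def rat_adjoin_eq span_power_basis by auto
  have "card (set bs) = card power_basis"
  proof (rule antisym)
    show "card (set bs) \<le> card power_basis"
      using rat_vs.independent_span_bound[of power_basis "set bs"] bs(2,3)
        rat_vs.span_superset[of "set bs"] by (simp del: One_nat_def)
    show "card power_basis \<le> card (set bs)"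
      using rat_vs.independent_span_bound[of "set bs" power_basis] bs(3) independent_power_basis
        rat_vs.span_superset[of power_basis] by (simp del: One_nat_def)
  qed
  with card_power_basis distinct_card[OF bs(1)] show ?thesis by simp
qed

text \<open>The right-hand side mentions neither \<open>bs\<close> nor \<open>A\<close>, so this
  also yields the independence of the basis that \<open>field_norm\<close> relies on.\<close>

lemma of_rat_det_eq_prod_conjugates:
  assumes basis: "rat_basis bs (rat_adjoin \<zeta>)" and A: "represents_mult A bs (rpoly f \<zeta>)"
  shows "of_rat (det A) = (\<Prod>k\<in>{1..<p}. rpoly f (\<zeta> ^ k))"
proof -
  let ?n = "p - 1"
  have len: "length bs = ?n" by (rule rat_basis_length[OF basis])
  have bs: "distinct bs" "rat_vs.span (set bs) = range (\<lambda>g. rpoly g \<zeta>)"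
    using basis by (auto simp: rat_basis_def rat_adjoin_eq)
  have carr: "A \<in> carrier_mat ?n ?n"
    and cols: "\<And>j. j < ?n \<Longrightarrow> rpoly f \<zeta> * bs ! j = (\<Sum>i<?n. of_rat (A $$ (i, j)) * bs ! i)"
    using A by (auto simp: represents_mult_def len)
  have "\<exists>g. bs ! j = rpoly g \<zeta>" if "j < ?n" for j
    using bs(2) rat_vs.span_base[of "bs ! j" "set bs"] that len by auto
  then obtain G where G: "\<And>j. j < ?n \<Longrightarrow> bs ! j = rpoly (G j) \<zeta>" by metis
  have "\<exists>c. \<zeta> ^ i = (\<Sum>j<?n. of_rat (c j) * bs ! j)" for i
  proof -
    have "\<zeta> ^ i \<in> rat_vs.span (set bs)"
      using root_pow_in_span[of i] unfolding span_power_basis bs(2) .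
    then show ?thesis by (rule rat_span_coordinates[OF bs(1)]) (auto simp: len)
  qed
  then obtain c where c: "\<And>i. \<zeta> ^ i = (\<Sum>j<?n. of_rat (c i j) * bs ! j)" by metis
  \<comment> \<open>Matrix indices start at 0 and the conjugates at exponent 1, hence
    \<open>Suc k\<close>. Row \<open>k\<close> of \<open>W\<close> is a left eigenvector of
    \<open>A'\<close> with eigenvalue \<open>rpoly f (\<zeta> ^ Suc k)\<close>.\<close>
  define W where "W = mat ?n ?n (\<lambda>(k, j). rpoly (G j) (\<zeta> ^ Suc k))"
  define D where "D = mat ?n ?n (\<lambda>(k, j). if k = j then rpoly f (\<zeta> ^ Suc k) else 0)"
  define C where "C = mat ?n ?n (\<lambda>(j, i). of_rat (c i j) :: 'a)"
  define A' where "A' = map_mat (of_rat :: rat \<Rightarrow> 'a) A"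
  define V where "V = mat ?n ?n (\<lambda>(k, i). (\<zeta> ^ Suc k) ^ i)"
  have mats: "W \<in> carrier_mat ?n ?n" "D \<in> carrier_mat ?n ?n" "C \<in> carrier_mat ?n ?n"
    "V \<in> carrier_mat ?n ?n" "A' \<in> carrier_mat ?n ?n"
    using carr by (auto simp: W_def D_def C_def V_def A'_def)
  have [simp]: "dim_row W = ?n" "dim_col W = ?n" "dim_row D = ?n" "dim_col D = ?n" "dim_row C = ?n"
    "dim_col C = ?n" "dim_row A' = ?n" "dim_col A' = ?n" "dim_row V = ?n" "dim_col V = ?n"
    "dim_row A = ?n" "dim_col A = ?n"
    using carr by (auto simp: W_def D_def C_def V_def A'_def)
  \<comment> \<open>Coordinates in the basis are rational, so they survive the passage from \<zeta>
    to a conjugate.\<close>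
  have conj: "rpoly g (\<zeta> ^ Suc k) = (\<Sum>i<?n. of_rat (d i) * rpoly (G i) (\<zeta> ^ Suc k))"
    if "rpoly g \<zeta> = (\<Sum>i<?n. of_rat (d i) * bs ! i)" "k < ?n" for g d k
  proof -
    have eq: "rpoly (g - (\<Sum>i<?n. smult (d i) (G i))) x =
        rpoly g x - (\<Sum>i<?n. of_rat (d i) * rpoly (G i) x)" for x :: 'a
      by (simp add: of_rat_poly_hom.hom_minus of_rat_poly_hom.hom_sum poly_sum of_rat_hom.map_poly_hom_smult)
    have "rpoly (g - (\<Sum>i<?n. smult (d i) (G i))) \<zeta> = 0"
      unfolding eq that(1) using G by simp
    then have "rpoly (g - (\<Sum>i<?n. smult (d i) (G i))) (\<zeta> ^ Suc k) = 0"
      by (rule rpoly_conjugate) (use that(2) in auto)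
    then show ?thesis unfolding eq by simp
  qed
  \<comment> \<open>\<open>C\<close> expresses the powers of \<zeta> in the basis, so the
    nonsingular Vandermonde matrix \<open>V\<close> forces \<open>W\<close> to be
    nonsingular.\<close>
  have "V = W * C"
  proof (rule eq_matI)
    fix k i assume ki: "k < dim_row (W * C)" "i < dim_col (W * C)"
    then have "(\<zeta> ^ Suc k) ^ i = (\<Sum>j<?n. of_rat (c i j) * rpoly (G j) (\<zeta> ^ Suc k))"
      using conj[of "monom 1 i" "c i" k] c[of i] by (simp add: poly_monom)
    then show "V $$ (k, i) = (W * C) $$ (k, i)"
      using ki by (simp add: V_def W_def C_def scalar_prod_def atLeast0LessThan mult.commute)
  qed simp_all
  then have "det V = det W * det C" using det_mult[OF mats(1,3)] by simp
  moreover have "inj_on (\<lambda>k. \<zeta> ^ Suc k) {..<?n}"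
  proof (rule inj_onI)
    fix x y assume "x \<in> {..<?n}" "y \<in> {..<?n}" "\<zeta> ^ Suc x = \<zeta> ^ Suc y"
    then have "Suc x = Suc y" by (intro inj_onD[OF inj_on_root_pow]) auto
    then show "x = y" by simp
  qed
  then have "det V \<noteq> 0" unfolding V_def by (rule det_vandermonde_nonzero)
  ultimately have W: "det W \<noteq> 0" by auto
  have "D * W = W * A'"
  proof (rule eq_matI)
    fix k j assume kj: "k < dim_row (W * A')" "j < dim_col (W * A')"
    have "rpoly (f * G j) \<zeta> = (\<Sum>i<?n. of_rat (A $$ (i, j)) * bs ! i)"
      using cols[of j] G[of j] kj by (simp add: of_rat_poly_hom.hom_mult)
    from conj[OF this, of k] kj
    have "rpoly f (\<zeta> ^ Suc k) * rpoly (G j) (\<zeta> ^ Suc k) =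
        (\<Sum>i<?n. of_rat (A $$ (i, j)) * rpoly (G i) (\<zeta> ^ Suc k))"
      by (simp add: of_rat_poly_hom.hom_mult)
    also have "\<dots> = (W * A') $$ (k, j)"
      using kj by (simp add: W_def A'_def scalar_prod_def atLeast0LessThan mult.commute)
    finally show "(D * W) $$ (k, j) = (W * A') $$ (k, j)"
      using kj by (simp add: D_def W_def scalar_prod_def if_distrib[of "\<lambda>x. x * _"] cong: if_cong)
  qed simp_all
  then have "det D * det W = det W * det A'"
    using det_mult[OF mats(2,1)] det_mult[OF mats(1,5)] by metis
  with W have "det A' = det D" by simp
  moreover have "det A' = of_rat (det A)" unfolding A'_def by simp
  moreover have "det D = (\<Prod>k<?n. rpoly f (\<zeta> ^ Suc k))"
  proof -
    have "det D = prod_list (diag_mat D)"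
      by (rule det_upper_triangular[of _ ?n]) (auto simp: D_def)
    then show ?thesis by (simp add: prod_list_diag_prod D_def atLeast0LessThan)
  qed
  moreover have "\<dots> = (\<Prod>k\<in>{1..<p}. rpoly f (\<zeta> ^ k))"
    using prod.shift_bounds_Suc_ivl[of "\<lambda>k. rpoly f (\<zeta> ^ k)" 0 ?n] p_gt_1
    by (simp add: atLeast0LessThan)
  ultimately show ?thesis by simp
qed

text \<open>The existence half of the definite description in \<open>field_norm\<close>, witnessed
  by the power basis.\<close>

lemma exists_basis_matrix:
  obtains bs A where "rat_basis bs (rat_adjoin \<zeta>)" "represents_mult A bs (rpoly f \<zeta>)"
proof -
  let ?n = "p - 1"
  define bs where "bs = map (\<lambda>i. \<zeta> ^ i) [0..<?n]"
  have set: "set bs = power_basis" by (auto simp: bs_def)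
  have dist: "distinct bs"
    using inj_on_power_basis by (simp add: bs_def distinct_map atLeast0LessThan)
  have len: "length bs = ?n" by (simp add: bs_def)
  have "\<exists>c. rpoly f \<zeta> * bs ! j = (\<Sum>i<?n. of_rat (c i) * bs ! i)" if "j < ?n" for j
  proof -
    have "rpoly f \<zeta> * bs ! j = rpoly (f * monom 1 j) \<zeta>"
      using that by (simp add: bs_def of_rat_poly_hom.hom_mult poly_monom)
    then have "rpoly f \<zeta> * bs ! j \<in> rat_vs.span (set bs)"
      unfolding set span_power_basis by blast
    then show ?thesis by (rule rat_span_coordinates[OF dist]) (auto simp: len)
  qed
  then obtain c where "\<And>j. j < ?n \<Longrightarrow> rpoly f \<zeta> * bs ! j = (\<Sum>i<?n. of_rat (c j i) * bs ! i)" by metis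
  \<comment> \<open>The coordinates \<open>c j\<close> of the \<open>j\<close>-th product form
    column \<open>j\<close>, so the indices are swapped.\<close>
  then have "represents_mult (mat ?n ?n (\<lambda>(i, j). c j i)) bs (rpoly f \<zeta>)"
    by (simp add: represents_mult_def len)
  moreover have "rat_basis bs (rat_adjoin \<zeta>)"
    using dist independent_power_basis span_power_basis
    by (simp add: rat_basis_def set rat_adjoin_eq del: One_nat_def)
  ultimately show ?thesis using that by blast
qed

lemma of_rat_field_norm:
  "of_rat (field_norm (rat_adjoin \<zeta>) (rpoly f \<zeta>)) = (\<Prod>k\<in>{1..<p}. rpoly f (\<zeta> ^ k))"
proof -
  obtain bs A where A: "rat_basis bs (rat_adjoin \<zeta>)" "represents_mult A bs (rpoly f \<zeta>)"
    by (rule exists_basis_matrix)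
  have "field_norm (rat_adjoin \<zeta>) (rpoly f \<zeta>) = det A"
    unfolding field_norm_def
  proof (rule the_equality)
    show "\<exists>bs A'. rat_basis bs (rat_adjoin \<zeta>) \<and> represents_mult A' bs (rpoly f \<zeta>) \<and> det A = det A'"
      using A by blast
  next
    fix d assume "\<exists>bs A. rat_basis bs (rat_adjoin \<zeta>) \<and> represents_mult A bs (rpoly f \<zeta>) \<and> d = det A"
    \<comment> \<open>Both determinants have the same product of conjugates as image, and
      \<open>of_rat\<close> is injective.\<close>
    then have "of_rat d = (of_rat (det A) :: 'a)" using of_rat_det_eq_prod_conjugates A by metis
    then show "d = det A" by simp
  qed
  then show ?thesis using of_rat_det_eq_prod_conjugates[OF A] by simp
qed

section \<open>Evaluation of the product by Lucas numbers\<close>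

text \<open>Both sides are monic of degree \<open>p - 1\<close> in \<open>x\<close> and agree at the
  \<open>p - 1\<close> conjugates, so their difference, of lower degree, is zero.\<close>

lemma prod_root_factors: "(\<Prod>k\<in>{1..<p}. x - \<zeta> ^ k) = (\<Sum>i<p. x ^ i)"
proof -
  let ?Q = "\<Prod>k\<in>{1..<p}. [:- (\<zeta> ^ k), 1:]"
  have p: "p > 0" using p_gt_1 by simp
  have deg: "degree ?Q = p - 1" by (subst degree_prod_eq_sum_degree) auto
  have "lead_coeff ?Q = 1" by (subst lead_coeff_prod) simp
  with deg have "coeff ?Q (p - 1) = 1" by simp
  then have "?Q = prime_cyclotomic p"
  proof (intro poly_eqI_degree_lead_coeff[of _ "p - 1" _ "(\<lambda>k. \<zeta> ^ k) ` {1..<p}"])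
    fix z assume "z \<in> (\<lambda>k. \<zeta> ^ k) ` {1..<p}"
    then obtain k where "k \<in> {1..<p}" "z = \<zeta> ^ k" by blast
    then show "poly ?Q z = poly (prime_cyclotomic p) z"
      using sum_conjugate_powers[of k] by (auto simp: poly_prod poly_prime_cyclotomic)
  qed (use p deg card_conjugates in \<open>simp_all add: coeff_prime_cyclotomic degree_prime_cyclotomic\<close>)
  from arg_cong[OF this, of "\<lambda>f. poly f x"] show ?thesis
    by (simp add: poly_prod poly_prime_cyclotomic)
qed

lemma prod_conjugates_eq_lucas:
  fixes \<phi> \<psi> :: 'a
  assumes "odd p" and sum: "\<phi> + \<psi> = 1" and prod: "\<phi> * \<psi> = - 1"
  shows "(\<Prod>k\<in>{1..<p}. 1 + \<zeta> ^ k - (\<zeta> ^ k)\<^sup>2) = of_nat (lucas p)"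
proof -
  have \<psi>: "\<psi> = 1 - \<phi>" using sum by (simp add: eq_diff_eq add.commute)
  have sq: "\<phi>\<^sup>2 = \<phi> + 1" using prod unfolding \<psi> by (simp add: power2_eq_square algebra_simps)
  \<comment> \<open>Binet's formula for Lucas numbers: both power sequences satisfy the recurrence
    because \<phi> and \<psi> are roots of X^2 - X - 1.\<close>
  have lucas: "of_nat (lucas n) = \<phi> ^ n + \<psi> ^ n" for n
  proof (induction n rule: lucas.induct)
    case (3 n)
    have "\<psi>\<^sup>2 = \<psi> + 1" using sq unfolding \<psi> by (simp add: power2_eq_square algebra_simps)
    then have "\<phi> ^ Suc (Suc n) + \<psi> ^ Suc (Suc n) = \<phi> ^ n * (\<phi> + 1) + \<psi> ^ n * (\<psi> + 1)"
      by (simp add: power2_eq_square flip: sq)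
    then show ?case using 3 by (simp add: algebra_simps)
  qed (simp_all add: sum)
  have fac: "1 + x - x\<^sup>2 = - 1 * ((\<phi> - x) * (\<psi> - x))" for x
    using sq unfolding \<psi> by (simp add: power2_eq_square algebra_simps)
  \<comment> \<open>The factor -1 occurs \<open>p - 1\<close> times, an even number.\<close>
  have lhs: "(\<Prod>k\<in>{1..<p}. 1 + \<zeta> ^ k - (\<zeta> ^ k)\<^sup>2) = (\<Sum>i<p. \<phi> ^ i) * (\<Sum>i<p. \<psi> ^ i)"
    unfolding fac prod.distrib prod_root_factors using \<open>odd p\<close> by simp
  have "(\<phi> - 1) * (\<Sum>i<p. \<phi> ^ i) = \<phi> ^ p - 1" "(\<psi> - 1) * (\<Sum>i<p. \<psi> ^ i) = \<psi> ^ p - 1"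
    by (simp_all add: power_diff_1_eq)
  then have "((\<phi> - 1) * (\<psi> - 1)) * ((\<Sum>i<p. \<phi> ^ i) * (\<Sum>i<p. \<psi> ^ i)) = (\<phi> ^ p - 1) * (\<psi> ^ p - 1)"
    by (metis mult.assoc mult.left_commute)
  moreover have "(\<phi> - 1) * (\<psi> - 1) = - 1"
  proof -
    have "(\<phi> - 1) * (\<psi> - 1) = \<phi> * \<psi> - (\<phi> + \<psi>) + 1" by (simp add: algebra_simps)
    then show ?thesis by (simp add: sum prod)
  qed
  moreover have "(\<phi> ^ p - 1) * (\<psi> ^ p - 1) = (\<phi> * \<psi>) ^ p - (\<phi> ^ p + \<psi> ^ p) + 1"
    by (simp add: power_mult_distrib algebra_simps)
  moreover have "(\<phi> * \<psi>) ^ p = - 1" using \<open>odd p\<close> by (simp add: prod)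
  ultimately have "- ((\<Sum>i<p. \<phi> ^ i) * (\<Sum>i<p. \<psi> ^ i)) = - of_nat (lucas p)"
    by (simp add: lucas)
  then show ?thesis unfolding lhs by (simp only: neg_equal_iff_equal)
qed

end

theorem theorem6p1:
  fixes p :: nat and \<zeta> :: "'a :: field_char_0"
  assumes "prime p" and "odd p"
    and "primitive_root_of_unity p \<zeta>"
  shows "field_norm (rat_adjoin \<zeta>) (1 + \<zeta> - \<zeta>\<^sup>2) = of_nat (lucas p)"
proof -
  interpret prime_root_of_unity p \<zeta> by unfold_locales (fact assms)+
  \<comment> \<open>The roots of $X^2 - X - 1$ need not lie in the given field.\<close>
  interpret ac: prime_root_of_unity p "to_ac \<zeta>"
    using assms by unfold_locales (auto simp: primitive_root_of_unity_def simp flip: to_ac_power)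
  have "degree ([:- 1, - 1, 1:] :: 'a alg_closure poly) > 0" by simp
  then obtain \<phi> :: "'a alg_closure" where "poly [:- 1, - 1, 1:] \<phi> = 0"
    using alg_closed_imp_poly_has_root by blast
  then have "\<phi> * (1 - \<phi>) = - 1" by (simp add: algebra_simps eq_neg_iff_add_eq_0)
  then have "to_ac (\<Prod>k\<in>{1..<p}. 1 + \<zeta> ^ k - (\<zeta> ^ k)\<^sup>2) = to_ac (of_nat (lucas p))"
    using ac.prod_conjugates_eq_lucas[OF \<open>odd p\<close>, of \<phi> "1 - \<phi>"] by (simp add: to_ac_prod)
  \<comment> \<open>Both sides come from the given field, and its embedding into the closure is
    injective.\<close>
  then have prod: "(\<Prod>k\<in>{1..<p}. 1 + \<zeta> ^ k - (\<zeta> ^ k)\<^sup>2) = of_nat (lucas p)"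
    by (simp only: to_ac_eq_iff)
  have f: "rpoly [:1, 1, - 1:] x = 1 + x - x\<^sup>2" for x :: 'a
    by (simp add: of_rat_hom.map_poly_pCons_hom power2_eq_square algebra_simps)
  have "of_rat (field_norm (rat_adjoin \<zeta>) (1 + \<zeta> - \<zeta>\<^sup>2)) = (of_rat (of_nat (lucas p)) :: 'a)"
    using of_rat_field_norm[of "[:1, 1, - 1:]"] unfolding f prod by simp
  then show ?thesis by (simp only: of_rat_eq_iff)
qed

end
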